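(* Let a real number $r>1$ be given (fixed). Then the graph functions $B_{r,q}$ and $XB$ are equivalent.
   Context: Graphs are finite and may have multiple edges and loops. For a graph $G=(V,E)$ and $A\subseteq E$, $\mathcal{C}(A)$ denotes the set of connected components of the spanning subgraph $(V,A)$, and $|C|$ denotes the number of vertices of $C\in\mathcal{C}(A)$. For $k\in\mathbb{N}$ (a non-negative integer), $q$ ranging over the non-negative integers, and $x$ real, the $(r,q)$-dichromatic function is $$B_{r,q}(G;x,k):=\sum_{A\subseteq E}x^{|A|}\prod_{C\in\mathcal{C}(A)}\sum_{i=0}^{k-1}r^{|C|q^i}$$ (with $0^0=1$). Here $r$ is fixed and $B_{r,q}(G;x,k)$ is regarded as a function of $q,x,k$. The symmetric function generalisation of the bad colouring polynomial is $$XB(G;t,x_0,x_1,\dots):=\sum_{s:V\to\{0,1,2,\dots\}}(1+t)^{b(s)}\prod_{v\in V}x_{s(v)},$$ where the sum ranges over all (not necessarily proper) colourings of $G$ by the colours $0,1,2,\dots$, and $b(s)=|\{uv\in E: s(u)=s(v)\}|$ is the number of monochromatic edges of $s$ (counted with multiplicity, loops being always monochromatic). A graph function $P=(P(G);\,G\text{ graph})$ determines a graph function $Q=(Q(G);\,G\text{ graph})$ if, for every $G$, any evaluation of $Q(G)$ can be obtained given an oracle which returns evaluations of $P(G)$, where the graph $G$ itself is not known when computing evaluations of $Q(G)$; in case $Q(G)$ is a polynomial (or a power series such as $XB(G)$), this means that the evaluations of $P(G)$ determine the coefficients of $Q(G)$. That is, for all graphs $G,G'$, if $P(G)$ and $P(G')$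 agree as functions of their arguments, then $Q(G)$ and $Q(G')$ agree. $P$ and $Q$ are equivalent if each determines the other. *)

theory Defs
  imports Complex_Main "HOL-Library.FuncSet" "HOL-Library.Uprod"
    "HOL-Library.Poly_Mapping" "HOL-Computational_Algebra.Polynomial"
begin

text \<open>
  Finite undirected multigraphs: distinct edges may have the same ends (multiple edges), and an
  edge with ends \<open>Upair v v\<close> is a loop. The values of \<open>ends\<close> outside \<open>edges\<close> are irrelevant.
\<close>

record ('v, 'e) multigraph =
  verts :: "'v set"
  edges :: "'e set"
  ends :: "'e \<Rightarrow> 'v uprod"

definition finite_graph :: "('v, 'e) multigraph \<Rightarrow> bool" where
  "finite_graph G \<longleftrightarrow> finite (verts G) \<and> finite (edges G) \<and>
     (\<forall>e\<in>edges G. set_uprod (ends G e) \<subseteq> verts G)"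

definition adjacency :: "('v, 'e) multigraph \<Rightarrow> 'e set \<Rightarrow> ('v \<times> 'v) set" where
  "adjacency G A = {(u, v). \<exists>e\<in>A. ends G e = Upair u v}"

definition components :: "('v, 'e) multigraph \<Rightarrow> 'e set \<Rightarrow> 'v set set" where
  "components G A = verts G // (adjacency G A)\<^sup>*"

definition rq_dichromatic :: "real \<Rightarrow> nat \<Rightarrow> ('v, 'e) multigraph \<Rightarrow> real \<Rightarrow> nat \<Rightarrow> real" where
  "rq_dichromatic r q G x k =
     (\<Sum>A\<in>Pow (edges G). x ^ card A * (\<Prod>C\<in>components G A. \<Sum>i<k. r ^ (card C * q ^ i)))"

definition mono_edges :: "('v, 'e) multigraph \<Rightarrow> ('v \<Rightarrow> nat) \<Rightarrow> nat" where
  "mono_edges G s = card {e \<in> edges G. \<exists>u v. ends G e = Upair u v \<and> s u = s v}"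

text \<open>
  A formal power series in the variables \<open>x\<^sub>0, x\<^sub>1, \<dots>\<close> is given by its coefficient function, indexed
  by finitely supported exponent vectors; here the coefficients are polynomials in \<open>t\<close>, and
  \<open>[:1, 1:]\<close> is \<open>1 + t\<close>. The sum \<open>\<Sum>v\<in>verts G. Poly_Mapping.single (s v) 1\<close> is the exponent vector
  of the monomial \<open>\<Prod>v\<in>verts G. x\<^bsub>s v\<^esub>\<close>, so \<open>XB G m\<close> collects the terms of the sum over all
  colourings that contribute to the monomial \<open>m\<close>. For finite \<open>G\<close> these are finitely many.
\<close>

definition XB :: "('v, 'e) multigraph \<Rightarrow> (nat \<Rightarrow>\<^sub>0 nat) \<Rightarrow> real poly" where
  "XB G m =
     (\<Sum>s | s \<in> verts G \<rightarrow>\<^sub>E UNIV \<and> (\<Sum>v\<in>verts G. Poly_Mapping.single (s v) 1) = m.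
        [:1, 1:] ^ mono_edges G s)"

text \<open>
  Graph functions are compared on all finite graphs over fixed but arbitrary types of vertices and
  edges. Every finite graph has an isomorphic copy over \<open>nat\<close>, and two graphs over different types
  both have copies over the sum types, so polymorphic statements cover all pairs of finite graphs.
\<close>

definition determines ::
    "(('v, 'e) multigraph \<Rightarrow> 'p) \<Rightarrow> (('v, 'e) multigraph \<Rightarrow> 'q) \<Rightarrow> bool" where
  "determines P Q \<longleftrightarrow>
     (\<forall>G G'. finite_graph G \<longrightarrow> finite_graph G' \<longrightarrow> P G = P G' \<longrightarrow> Q G = Q G')"

definition equivalent_graph_functions ::
    "(('v, 'e) multigraph \<Rightarrow> 'p) \<Rightarrow> (('v, 'e) multigraph \<Rightarrow> 'q) \<Rightarrow> bool" where
  "equivalent_graph_functions P Q \<longleftrightarrow> determines P Q \<and> determines Q P"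

end

theory Submission
  imports Defs
begin

text \<open>
  Expanding \<open>(1 + x) ^ b s\<close> over sets of monochromatic edges shows that \<open>B\<close> is the specialisation of
  \<open>XB\<close> with \<open>t = x\<close>, \<open>x\<^sub>i = r ^ q ^ i\<close> for \<open>i < k\<close> and \<open>x\<^sub>i = 0\<close> for \<open>i \<ge> k\<close>. So \<open>XB\<close> determines \<open>B\<close>.
  Conversely, \<open>B\<close> at \<open>x = 0\<close>, \<open>k = 1\<close> is \<open>r ^ n\<close>, which gives the number \<open>n\<close> of vertices, and a monomial
  of degree \<open>n\<close> with exponents \<open>m\<^sub>i\<close> specialises to \<open>r\<close> to the power \<open>\<Sum>i<k. m\<^sub>i * q ^ i\<close>. For distinct
  monomials of the same degree these polynomials in \<open>q\<close> differ by a nonconstant polynomial, so the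
  specialised monomials have different growth rates as \<open>q\<close> tends to infinity and are therefore
  linearly independent as functions of \<open>q\<close>.
\<close>

subsection \<open>Expansion over colourings\<close>

lemma sum_Pow_power_card:
  fixes x :: "'a :: comm_semiring_1"
  assumes "finite M"
  shows "(\<Sum>A\<in>Pow M. x ^ card A) = (1 + x) ^ card M"
  using prod_add[OF assms, of "\<lambda>_. x" "\<lambda>_. 1"] by (simp add: add.commute)

lemma quotient_class_eq:
  assumes "equiv V R" "C \<in> V // R" "v \<in> C"
  shows "R `` {v} = C"
proof -
  obtain a where "C = R `` {a}"
    using assms(2) by (rule quotientE)
  with assms(3) equiv_class_eq[OF assms(1), of a v] show ?thesis
    by simp
qed

text \<open>Multiplying out picks one index for each class, which amounts to a map on
  \<open>V\<close> that is constant on classes. The power \<open>w i ^ card C\<close> is the product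
  of \<open>w i\<close> over the elements of \<open>C\<close>.\<close>

lemma prod_quotient_sum_power_card:
  fixes w :: "'i \<Rightarrow> 'a :: comm_semiring_1"
  assumes "finite V" and R: "equiv V R" and "finite K"
  shows "(\<Prod>C\<in>V // R. \<Sum>i\<in>K. w i ^ card C) =
    (\<Sum>s | s \<in> V \<rightarrow>\<^sub>E K \<and> (\<forall>(u, v)\<in>R. s u = s v). \<Prod>v\<in>V. w (s v))"
proof -
  let ?S = "{s. s \<in> V \<rightarrow>\<^sub>E K \<and> (\<forall>(u, v)\<in>R. s u = s v)}"
  have fin: "finite (V // R)"
    using assms by (simp add: finite_quotient equiv_type)
  have some: "(SOME v. v \<in> C) \<in> C" if "C \<in> V // R" for C
    using in_quotient_imp_non_empty[OF R that] by (simp add: some_in_eq)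
  have someV: "(SOME v. v \<in> C) \<in> V" if "C \<in> V // R" for C
    using in_quotient_imp_subset[OF R that] some[OF that] by (rule subsetD)
  have "(\<Prod>C\<in>V // R. \<Sum>i\<in>K. w i ^ card C) =
      (\<Sum>g\<in>V // R \<rightarrow>\<^sub>E K. \<Prod>C\<in>V // R. w (g C) ^ card C)"
    using fin assms(3) by (intro prod_sum_PiE)
  also have "\<dots> = (\<Sum>s\<in>?S. \<Prod>v\<in>V. w (s v))"
  \<comment> \<open>\<open>j\<close> pulls a choice on classes back to elements; \<open>i\<close>
    reads the index of a class off an arbitrary representative.\<close>
  proof (rule sum.reindex_bij_witness
      [where i = "\<lambda>s. \<lambda>C\<in>V // R. s (SOME v. v \<in> C)" and j = "\<lambda>g. \<lambda>v\<in>V. g (R `` {v})"])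
    fix g assume g: "g \<in> V // R \<rightarrow>\<^sub>E K"
    show "(\<lambda>C\<in>V // R. (\<lambda>v\<in>V. g (R `` {v})) (SOME v. v \<in> C)) = g"
    proof (rule extensionalityI)
      show "g \<in> extensional (V // R)"
        using g by (simp add: PiE_iff)
    qed (simp_all add: someV quotient_class_eq[OF R _ some])
    show "(\<lambda>v\<in>V. g (R `` {v})) \<in> ?S"
    proof (intro CollectI conjI ballI)
      show "(\<lambda>v\<in>V. g (R `` {v})) \<in> V \<rightarrow>\<^sub>E K"
        using g by (auto intro!: PiE_mem[OF g] quotientI)
      fix e assume "e \<in> R"
      then show "case e of (u, v) \<Rightarrow> (\<lambda>v\<in>V. g (R `` {v})) u = (\<lambda>v\<in>V. g (R `` {v})) v"
        using equiv_class_eq_iff[OF R] by (cases e) auto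
    qed
    have "(\<Prod>v\<in>V. w ((\<lambda>v\<in>V. g (R `` {v})) v)) = (\<Prod>v\<in>\<Union>(V // R). w (g (R `` {v})))"
      using Union_quotient[OF R] by simp
    also have "\<dots> = (\<Prod>C\<in>V // R. \<Prod>v\<in>C. w (g (R `` {v})))"
    proof (subst prod.Union_disjoint)
      show "\<forall>C\<in>V // R. finite C"
        using in_quotient_imp_subset[OF R] \<open>finite V\<close> finite_subset by blast
      show "\<forall>A\<in>V // R. \<forall>B\<in>V // R. A \<noteq> B \<longrightarrow> A \<inter> B = {}"
        using quotient_disj[OF R] by blast
    qed simp
    also have "\<dots> = (\<Prod>C\<in>V // R. \<Prod>v\<in>C. w (g C))"
      by (simp add: quotient_class_eq[OF R] cong: prod.cong)
    finally show "(\<Prod>v\<in>V. w ((\<lambda>v\<in>V. g (R `` {v})) v)) = (\<Prod>C\<in>V // R. w (g C) ^ card C)"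
      by simp
  next
    fix s assume s: "s \<in> ?S"
    have const: "s (SOME u. u \<in> R `` {v}) = s v" if "v \<in> V" for v
      using some[OF quotientI[OF that]] s by force
    show "(\<lambda>v\<in>V. (\<lambda>C\<in>V // R. s (SOME v. v \<in> C)) (R `` {v})) = s"
    proof (rule extensionalityI)
      show "s \<in> extensional V"
        using s by (simp add: PiE_iff)
    qed (simp_all add: quotientI const del: Image_singleton_iff)
    show "(\<lambda>C\<in>V // R. s (SOME v. v \<in> C)) \<in> V // R \<rightarrow>\<^sub>E K"
      using s by (simp add: PiE_iff someV Pi_iff)
  qed
  finally show ?thesis .
qed

lemma equiv_reachable:
  "equiv (verts G) ((adjacency G A)\<^sup>* \<inter> verts G \<times> verts G)"
proof (rule equivI)
  have "sym (adjacency G A)"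
    by (auto simp: sym_def adjacency_def)
       (metis Upair_inject)
  then show "sym ((adjacency G A)\<^sup>* \<inter> verts G \<times> verts G)"
    by (auto intro!: symI dest: symD[OF sym_rtrancl])
qed (auto simp: refl_on_def trans_def)

text \<open>Paths along edges of \<open>A\<close> never leave \<open>verts G\<close>, so cutting the
  closure down to \<open>verts G\<close> changes no class of a vertex. The restricted relation is an
  equivalence on \<open>verts G\<close>, as the lemmas on quotients require.\<close>

lemma components_eq_quotient:
  assumes "finite_graph G" "A \<subseteq> edges G"
  shows "components G A = verts G // ((adjacency G A)\<^sup>* \<inter> verts G \<times> verts G)"
proof -
  have "v \<in> verts G" if "(u, v) \<in> (adjacency G A)\<^sup>*" "u \<in> verts G" for u v
    using that by (induction) (use assms in \<open>auto simp: adjacency_def finite_graph_def dest!: subsetD\<close>)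
  then have "(adjacency G A)\<^sup>* `` {v} = ((adjacency G A)\<^sup>* \<inter> verts G \<times> verts G) `` {v}"
    if "v \<in> verts G" for v
    using that by auto
  then show ?thesis
    by (simp add: components_def quotient_def)
qed

definition mono_set :: "('v, 'e) multigraph \<Rightarrow> ('v \<Rightarrow> nat) \<Rightarrow> 'e set" where
  "mono_set G s = {e \<in> edges G. \<exists>u v. ends G e = Upair u v \<and> s u = s v}"

text \<open>An edge is a path of length one, and conversely equality of colours propagates along
  paths by induction.\<close>

lemma constant_on_components_iff:
  assumes "finite_graph G" "A \<subseteq> edges G"
  shows "(\<forall>(u, v)\<in>(adjacency G A)\<^sup>* \<inter> verts G \<times> verts G. s u = s v) \<longleftrightarrow> A \<subseteq> mono_set G s"
proof
  assume L: "\<forall>(u, v)\<in>(adjacency G A)\<^sup>* \<inter> verts G \<times> verts G. s u = s v"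
  show "A \<subseteq> mono_set G s"
  proof
    fix e assume e: "e \<in> A"
    obtain u v where uv: "ends G e = Upair u v"
      by (metis uprod_exhaust)
    then have "(u, v) \<in> adjacency G A" "u \<in> verts G" "v \<in> verts G"
      using e assms by (fastforce simp: adjacency_def finite_graph_def)+
    then have "s u = s v"
      using L by blast
    then show "e \<in> mono_set G s"
      using e uv assms by (auto simp: mono_set_def)
  qed
next
  assume R: "A \<subseteq> mono_set G s"
  have "s u = s v" if "(u, v) \<in> (adjacency G A)\<^sup>*" for u v
    using that by induction (use R in \<open>auto simp: adjacency_def mono_set_def dest!: subsetD\<close>)
  then show "\<forall>(u, v)\<in>(adjacency G A)\<^sup>* \<inter> verts G \<times> verts G. s u = s v"
    by auto
qed

text \<open>Both sides sum over pairs of an edge set \<open>A\<close> and a colouring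
  \<open>s\<close> that makes every edge of \<open>A\<close> monochromatic, grouped by
  \<open>A\<close> on the left and by \<open>s\<close> on the right.\<close>

lemma sum_components_eq_sum_colourings:
  fixes x :: "'a :: comm_semiring_1"
  assumes "finite_graph G" "finite K"
  shows "(\<Sum>A\<in>Pow (edges G). x ^ card A * (\<Prod>C\<in>components G A. \<Sum>i\<in>K. w i ^ card C)) =
    (\<Sum>s\<in>verts G \<rightarrow>\<^sub>E K. (1 + x) ^ mono_edges G s * (\<Prod>v\<in>verts G. w (s v)))"
proof -
  have fin: "finite (verts G)" "finite (edges G)"
    using assms by (auto simp: finite_graph_def)
  have "(\<Sum>A\<in>Pow (edges G). x ^ card A * (\<Prod>C\<in>components G A. \<Sum>i\<in>K. w i ^ card C)) =
    (\<Sum>A\<in>Pow (edges G). \<Sum>s | s \<in> verts G \<rightarrow>\<^sub>E K \<and> A \<subseteq> mono_set G s.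
       x ^ card A * (\<Prod>v\<in>verts G. w (s v)))"
    using assms fin
    by (intro sum.cong refl)
       (simp add: components_eq_quotient prod_quotient_sum_power_card equiv_reachable
         constant_on_components_iff sum_distrib_left)
  also have "\<dots> = (\<Sum>s\<in>verts G \<rightarrow>\<^sub>E K. \<Sum>A | A \<in> Pow (edges G) \<and> A \<subseteq> mono_set G s.
       x ^ card A * (\<Prod>v\<in>verts G. w (s v)))"
    using sum.swap_restrict[of "Pow (edges G)" "verts G \<rightarrow>\<^sub>E K"
        "\<lambda>A s. x ^ card A * (\<Prod>v\<in>verts G. w (s v))" "\<lambda>A s. A \<subseteq> mono_set G s"] fin assms(2)
    by (simp add: finite_PiE)
  also have "\<dots> = (\<Sum>s\<in>verts G \<rightarrow>\<^sub>E K. (1 + x) ^ mono_edges G s * (\<Prod>v\<in>verts G. w (s v)))"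
  proof (intro sum.cong refl)
    fix s
    have "{A. A \<in> Pow (edges G) \<and> A \<subseteq> mono_set G s} = Pow (mono_set G s)"
      by (auto simp: mono_set_def)
    moreover have "finite (mono_set G s)"
      using fin by (simp add: mono_set_def)
    ultimately show "(\<Sum>A | A \<in> Pow (edges G) \<and> A \<subseteq> mono_set G s.
        x ^ card A * (\<Prod>v\<in>verts G. w (s v))) = (1 + x) ^ mono_edges G s * (\<Prod>v\<in>verts G. w (s v))"
      by (simp add: sum_Pow_power_card mono_edges_def mono_set_def flip: sum_distrib_right)
  qed
  finally show ?thesis .
qed

lemma rq_dichromatic_eq_sum_colourings:
  assumes "finite_graph G"
  shows "rq_dichromatic r q G x k =
    (\<Sum>s\<in>verts G \<rightarrow>\<^sub>E {..<k}. (1 + x) ^ mono_edges G s * (\<Prod>v\<in>verts G. r ^ (q ^ s v)))"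
  using sum_components_eq_sum_colourings[OF assms, of "{..<k}" x "\<lambda>i. r ^ (q ^ i)"]
  by (simp add: rq_dichromatic_def mult.commute flip: power_mult)

subsection \<open>Collecting colourings by monomial\<close>

definition colour_type :: "'v set \<Rightarrow> ('v \<Rightarrow> nat) \<Rightarrow> nat \<Rightarrow>\<^sub>0 nat" where
  "colour_type V s = (\<Sum>v\<in>V. Poly_Mapping.single (s v) 1)"

lemma lookup_colour_type:
  assumes "finite V"
  shows "Poly_Mapping.lookup (colour_type V s) i = card {v \<in> V. s v = i}"
  using assms by (simp add: colour_type_def lookup_sum lookup_single when_def flip: sum.inter_filter)

lemma keys_colour_type:
  assumes "finite V"
  shows "Poly_Mapping.keys (colour_type V s) = s ` V"
  using assms by (auto simp: in_keys_iff lookup_colour_type card_gt_0_iff)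

text \<open>The keys are the colours used, so whether all colours lie below \<open>k\<close> depends
  on the monomial alone.\<close>

lemma PiE_lessThan_iff_keys:
  assumes "finite V"
  shows "s \<in> V \<rightarrow>\<^sub>E {..<k} \<longleftrightarrow>
    s \<in> V \<rightarrow>\<^sub>E UNIV \<and> Poly_Mapping.keys (colour_type V s) \<subseteq> {..<k}"
  by (auto simp: keys_colour_type[OF assms] PiE_iff)

lemma sum_lookup_colour_type:
  assumes "finite V" "s \<in> V \<rightarrow> {..<k}"
  shows "(\<Sum>i<k. Poly_Mapping.lookup (colour_type V s) i) = card V"
  using sum.group[of V "{..<k}" s "\<lambda>_. 1 :: nat"] assms by (auto simp: lookup_colour_type)

lemma prod_power_lookup_colour_type:
  fixes w :: "nat \<Rightarrow> 'a :: comm_semiring_1"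
  assumes "finite V" "s \<in> V \<rightarrow> {..<k}"
  shows "(\<Prod>i<k. w i ^ Poly_Mapping.lookup (colour_type V s) i) = (\<Prod>v\<in>V. w (s v))"
proof -
  have "(\<Prod>v\<in>V. w (s v)) = (\<Prod>i<k. \<Prod>v | v \<in> V \<and> s v = i. w (s v))"
    using assms by (subst prod.group) auto
  also have "\<dots> = (\<Prod>i<k. \<Prod>v | v \<in> V \<and> s v = i. w i)"
    by (intro prod.cong) auto
  finally show ?thesis
    using assms by (simp add: lookup_colour_type)
qed

definition colour_types :: "'v set \<Rightarrow> nat \<Rightarrow> (nat \<Rightarrow>\<^sub>0 nat) set" where
  "colour_types V k = colour_type V ` (V \<rightarrow>\<^sub>E {..<k})"

lemma finite_colour_types: "finite V \<Longrightarrow> finite (colour_types V k)"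
  by (simp add: colour_types_def finite_PiE)

lemma keys_colour_types: "finite V \<Longrightarrow> m \<in> colour_types V k \<Longrightarrow> Poly_Mapping.keys m \<subseteq> {..<k}"
  by (auto simp: colour_types_def keys_colour_type PiE_mem)

lemma XB_eq_0:
  assumes "finite (verts G)" "Poly_Mapping.keys m \<subseteq> {..<k}" "m \<notin> colour_types (verts G) k"
  shows "XB G m = 0"
proof -
  have "{s. s \<in> verts G \<rightarrow>\<^sub>E UNIV \<and> colour_type (verts G) s = m} = {}"
    using assms(2,3) by (auto simp: colour_types_def PiE_lessThan_iff_keys[OF assms(1)])
  then show ?thesis
    unfolding XB_def colour_type_def by (simp only: sum.empty)
qed

text \<open>Grouping colourings by monomial. \<open>M\<close> may exceed the monomials that occur,
  which lets two graphs be expanded over one index set; the extra terms are empty sums.\<close>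

lemma rq_dichromatic_eq_sum_XB:
  assumes "finite_graph G" "finite M" "colour_types (verts G) k \<subseteq> M"
    and "\<And>m. m \<in> M \<Longrightarrow> Poly_Mapping.keys m \<subseteq> {..<k}"
  shows "rq_dichromatic r q G x k =
    (\<Sum>m\<in>M. poly (XB G m) x * r ^ (\<Sum>i<k. Poly_Mapping.lookup m i * q ^ i))"
proof -
  let ?V = "verts G" and ?w = "\<lambda>i. r ^ (q ^ i)"
  have fin: "finite ?V"
    using assms by (simp add: finite_graph_def)
  have "rq_dichromatic r q G x k =
      (\<Sum>s\<in>?V \<rightarrow>\<^sub>E {..<k}. (1 + x) ^ mono_edges G s * (\<Prod>v\<in>?V. ?w (s v)))"
    using assms(1) by (rule rq_dichromatic_eq_sum_colourings)
  also have "\<dots> = (\<Sum>m\<in>M. \<Sum>s | s \<in> ?V \<rightarrow>\<^sub>E {..<k} \<and> colour_type ?V s = m.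
      (1 + x) ^ mono_edges G s * (\<Prod>v\<in>?V. ?w (s v)))"
    using assms fin by (subst sum.group) (auto simp: colour_types_def finite_PiE)
  also have "\<dots> = (\<Sum>m\<in>M. poly (XB G m) x * r ^ (\<Sum>i<k. Poly_Mapping.lookup m i * q ^ i))"
  proof (intro sum.cong refl)
    fix m assume m: "m \<in> M"
    \<comment> \<open>\<open>XB\<close> admits all colours, but a colouring with monomial
      \<open>m\<close> uses only colours below \<open>k\<close>.\<close>
    have eq: "{s. s \<in> ?V \<rightarrow>\<^sub>E {..<k} \<and> colour_type ?V s = m} =
        {s. s \<in> ?V \<rightarrow>\<^sub>E UNIV \<and> colour_type ?V s = m}"
      using assms(4)[OF m] by (auto simp: PiE_lessThan_iff_keys[OF fin])
    have "(\<Sum>s | s \<in> ?V \<rightarrow>\<^sub>E {..<k} \<and> colour_type ?V s = m.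
        (1 + x) ^ mono_edges G s * (\<Prod>v\<in>?V. ?w (s v))) =
      (\<Sum>s | s \<in> ?V \<rightarrow>\<^sub>E {..<k} \<and> colour_type ?V s = m.
        (1 + x) ^ mono_edges G s * (\<Prod>i<k. ?w i ^ Poly_Mapping.lookup m i))"
      using prod_power_lookup_colour_type[OF fin, of _ k ?w]
      by (intro sum.cong refl) (auto simp: PiE_iff)
    also have "\<dots> = poly (XB G m) x * (\<Prod>i<k. ?w i ^ Poly_Mapping.lookup m i)"
      unfolding eq
      by (simp add: XB_def colour_type_def poly_sum sum_distrib_right)
    also have "(\<Prod>i<k. ?w i ^ Poly_Mapping.lookup m i) =
        r ^ (\<Sum>i<k. Poly_Mapping.lookup m i * q ^ i)"
      by (simp add: power_sum mult.commute flip: power_mult)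
    finally show "(\<Sum>s | s \<in> ?V \<rightarrow>\<^sub>E {..<k} \<and> colour_type ?V s = m.
        (1 + x) ^ mono_edges G s * (\<Prod>v\<in>?V. ?w (s v))) =
        poly (XB G m) x * r ^ (\<Sum>i<k. Poly_Mapping.lookup m i * q ^ i)" .
  qed
  finally show ?thesis .
qed

subsection \<open>Independence of exponentials of polynomials\<close>

text \<open>Writing \<open>p\<close> as \<open>a + x * q\<close>, the factor \<open>q\<close> is
  eventually at least its positive leading coefficient, so \<open>p\<close> eventually dominates a
  linear function of positive slope.\<close>

lemma filterlim_poly_at_top:
  fixes p :: "real poly"
  assumes "degree p > 0" "lead_coeff p > 0"
  shows "filterlim (poly p) at_top at_top"
proof -
  obtain a q where p: "p = pCons a q"
    by (cases p) auto
  with assms have lc: "lead_coeff q > 0"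
    by (auto split: if_splits)
  obtain n where n: "\<And>x. x \<ge> n \<Longrightarrow> poly q x \<ge> lead_coeff q"
    using poly_pinfty_gt_lc[OF lc] by blast
  have "filterlim (\<lambda>x. a + lead_coeff q * x) at_top at_top"
    using lc by (intro filterlim_tendsto_add_at_top[OF tendsto_const]
        filterlim_tendsto_pos_mult_at_top[OF tendsto_const] filterlim_ident)
  moreover have "eventually (\<lambda>x. a + lead_coeff q * x \<le> poly p x) at_top"
    using eventually_ge_at_top[of "max n 0"]
    by eventually_elim (use n in \<open>auto simp: p mult.commute intro!: mult_left_mono\<close>)
  ultimately show ?thesis
    by (rule filterlim_at_top_mono)
qed

text \<open>Dividing by the fastest growing term with nonzero coefficient makes every other term
  tend to 0, so that coefficient must vanish. Polynomials differing by a constant would give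
  proportional functions, hence \<open>nonconst\<close>.\<close>

lemma powr_poly_independent:
  fixes r :: real and P :: "real poly set"
  assumes "r > 1" "finite P"
    and nonconst: "\<And>p p'. p \<in> P \<Longrightarrow> p' \<in> P \<Longrightarrow> p \<noteq> p' \<Longrightarrow> degree (p - p') > 0"
    and zero: "\<And>n :: nat. (\<Sum>p\<in>P. c p * r powr poly p (real n)) = 0"
    and "p \<in> P"
  shows "c p = 0"
proof (rule ccontr)
  assume "c p \<noteq> 0"
  define Q where "Q = {p \<in> P. c p \<noteq> 0}"
  \<comment> \<open>The order on real polynomials compares by the sign of the leading coefficient of
    the difference, so \<open>d\<close> is the eventually largest element of
    \<open>Q\<close>.\<close>
  define d where "d = Max Q"
  have Q: "finite Q" "Q \<noteq> {}" "Q \<subseteq> P"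
    using assms \<open>c p \<noteq> 0\<close> by (auto simp: Q_def)
  then have d: "d \<in> Q"
    by (simp add: d_def)
  have zero': "(\<Sum>p\<in>Q. c p * r powr - poly (d - p) (real n)) = 0" for n :: nat
  proof -
    have "(\<Sum>p\<in>Q. c p * r powr - poly (d - p) (real n)) =
        (\<Sum>p\<in>P. c p * r powr - poly (d - p) (real n))"
      using assms(2) by (intro sum.mono_neutral_left) (auto simp: Q_def)
    also have "\<dots> = (\<Sum>p\<in>P. c p * r powr poly p (real n)) * r powr - poly d (real n)"
      unfolding sum_distrib_right
      by (intro sum.cong refl) (simp add: mult.assoc flip: powr_add)
    finally show ?thesis
      using zero by simp
  qed
  have lim: "(\<lambda>n :: nat. c p * r powr - poly (d - p) (real n)) \<longlonglongrightarrow> (if p = d then c d else 0)"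
    if "p \<in> Q" for p
  proof (cases "p = d")
    case False
    have "p < d"
      using False that Q by (simp add: d_def order_less_le)
    then have "lead_coeff (d - p) > 0"
      by (simp add: less_poly_def pos_poly_def)
    moreover have "degree (d - p) > 0"
      using nonconst False that d Q by (metis subsetD)
    ultimately have "filterlim (\<lambda>n :: nat. poly (d - p) (real n)) at_top sequentially"
      by (intro filterlim_compose[OF filterlim_poly_at_top filterlim_real_sequentially])
    then have "filterlim (\<lambda>n :: nat. ln r * poly (d - p) (real n)) at_top sequentially"
      using \<open>r > 1\<close> by (intro filterlim_tendsto_pos_mult_at_top[OF tendsto_const]) auto
    then have "(\<lambda>n :: nat. exp (- (ln r * poly (d - p) (real n)))) \<longlonglongrightarrow> 0"
      by (intro filterlim_compose[OF exp_at_bot]) (simp add: filterlim_uminus_at_bot)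
    then have "(\<lambda>n :: nat. r powr - poly (d - p) (real n)) \<longlonglongrightarrow> 0"
      using \<open>r > 1\<close> by (simp add: powr_def mult.commute del: poly_diff)
    then show ?thesis
      using False by (auto intro: tendsto_mult_right_zero)
  qed (use \<open>r > 1\<close> in simp)
  have "(\<lambda>n :: nat. \<Sum>p\<in>Q. c p * r powr - poly (d - p) (real n)) \<longlonglongrightarrow>
      (\<Sum>p\<in>Q. if p = d then c d else 0)"
    by (intro tendsto_sum lim)
  then have "c d = 0"
    using Q d unfolding zero' by (simp add: LIMSEQ_const_iff)
  with d show False
    by (simp add: Q_def)
qed

section \<open>Exponents of specialised monomials as polynomials in \<open>q\<close>\<close>

definition exponent_poly :: "nat \<Rightarrow> (nat \<Rightarrow>\<^sub>0 nat) \<Rightarrow> real poly" where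
  "exponent_poly k m = (\<Sum>i<k. monom (real (Poly_Mapping.lookup m i)) i)"

lemma coeff_exponent_poly:
  "coeff (exponent_poly k m) i = (if i < k then real (Poly_Mapping.lookup m i) else 0)"
  by (simp add: exponent_poly_def coeff_sum)

lemma poly_exponent_poly:
  "poly (exponent_poly k m) (real q) = real (\<Sum>i<k. Poly_Mapping.lookup m i * q ^ i)"
  by (simp add: exponent_poly_def poly_sum poly_monom)

text \<open>
  Since \<open>q ^ 0 = 1\<close>, monomials differing only in the power of \<open>x\<^sub>0\<close> have exponents that differ by
  a constant, which large \<open>q\<close> does not separate; equal total degree rules this out.
\<close>

lemma degree_diff_exponent_poly:
  assumes "Poly_Mapping.keys m \<subseteq> {..<k}" "Poly_Mapping.keys m' \<subseteq> {..<k}"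
    and total: "(\<Sum>i<k. Poly_Mapping.lookup m i) = (\<Sum>i<k. Poly_Mapping.lookup m' i)"
    and "m \<noteq> m'"
  shows "degree (exponent_poly k m - exponent_poly k m') > 0"
proof (rule ccontr)
  assume "\<not> ?thesis"
  then have deg: "degree (exponent_poly k m - exponent_poly k m') = 0"
    by simp
  have outside: "Poly_Mapping.lookup m i = Poly_Mapping.lookup m' i" if "\<not> i < k" for i
  proof -
    have "i \<notin> Poly_Mapping.keys m" "i \<notin> Poly_Mapping.keys m'"
      using assms(1,2) that by auto
    then show ?thesis
      by (simp add: not_in_keys_iff_lookup_eq_zero)
  qed
  have nonzero: "Poly_Mapping.lookup m i = Poly_Mapping.lookup m' i" if "i \<noteq> 0" for i
  proof (cases "i < k")
    case True
    have "coeff (exponent_poly k m - exponent_poly k m') i = 0"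
      using deg that by (intro coeff_eq_0) simp
    with True show ?thesis
      by (simp add: coeff_exponent_poly)
  qed (rule outside)
  have "Poly_Mapping.lookup m 0 = Poly_Mapping.lookup m' 0"
  proof (cases "0 < k")
    case True
    have "(\<Sum>i\<in>{..<k} - {0}. Poly_Mapping.lookup m i) =
        (\<Sum>i\<in>{..<k} - {0}. Poly_Mapping.lookup m' i)"
      by (intro sum.cong refl nonzero) auto
    moreover have "(\<Sum>i<k. f i) = f 0 + (\<Sum>i\<in>{..<k} - {0}. f i)" for f :: "nat \<Rightarrow> nat"
      using True by (intro sum.remove) auto
    ultimately show ?thesis
      using total by (metis add_right_cancel)
  qed (rule outside)
  then have "Poly_Mapping.lookup m i = Poly_Mapping.lookup m' i" for i
    using nonzero by (cases "i = 0") auto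
  then have "m = m'"
    by (rule poly_mapping_eqI)
  with \<open>m \<noteq> m'\<close> show False
    by simp
qed

section \<open>Equivalence of the two graph functions\<close>

lemma rq_dichromatic_0_1:
  assumes "finite_graph G"
  shows "rq_dichromatic r q G 0 1 = r ^ card (verts G)"
proof -
  have *: "verts G \<rightarrow>\<^sub>E {..<1 :: nat} = {\<lambda>v\<in>verts G. 0}"
    by (auto simp: PiE_iff extensional_def restrict_def fun_eq_iff)
  show ?thesis
    unfolding rq_dichromatic_eq_sum_colourings[OF assms] * by simp
qed

theorem theorem1:
  fixes r :: real
  assumes "r > 1"
  shows "equivalent_graph_functions
    (\<lambda>G :: ('v, 'e) multigraph. \<lambda>(q :: nat) (x :: real) (k :: nat). rq_dichromatic r q G x k)
    (XB :: ('v, 'e) multigraph \<Rightarrow> (nat \<Rightarrow>\<^sub>0 nat) \<Rightarrow> real poly)"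
  unfolding equivalent_graph_functions_def determines_def
proof (intro conjI allI impI ext)
  fix G G' :: "('v, 'e) multigraph" and m :: "nat \<Rightarrow>\<^sub>0 nat"
  assume G: "finite_graph G" "finite_graph G'"
    and eq: "(\<lambda>q x k. rq_dichromatic r q G x k) = (\<lambda>q x k. rq_dichromatic r q G' x k)"
  have eq: "rq_dichromatic r q G x k = rq_dichromatic r q G' x k" for q x k
    using eq by metis
  \<comment> \<open>The number of colours is chosen so that no variable of \<open>m\<close> is set
    to 0.\<close>
  obtain k where k: "Poly_Mapping.keys m \<subseteq> {..<k}"
    using finite_nat_bounded[OF finite_keys] by blast
  define M where "M = colour_types (verts G) k \<union> colour_types (verts G') k"
  have fin: "finite (verts G)" "finite (verts G')"
    using G by (auto simp: finite_graph_def)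
  have M: "finite M" "\<And>m. m \<in> M \<Longrightarrow> Poly_Mapping.keys m \<subseteq> {..<k}"
    using fin keys_colour_types by (auto simp: M_def finite_colour_types)
  \<comment> \<open>Since \<open>r > 1\<close>, the power of \<open>r\<close> at
    \<open>x = 0\<close>, \<open>k = 1\<close> reveals the number of vertices. Hence all monomials
    in \<open>M\<close>, from either graph, have the same degree.\<close>
  have card: "card (verts G) = card (verts G')"
    using eq[of 0 0 1] assms unfolding rq_dichromatic_0_1[OF G(1)] rq_dichromatic_0_1[OF G(2)]
    by simp
  have total: "(\<Sum>i<k. Poly_Mapping.lookup m i) = card (verts G)" if "m \<in> M" for m
    using that fin card by (auto simp: M_def colour_types_def PiE_def sum_lookup_colour_type)
  have nonconst: "degree (exponent_poly k m - exponent_poly k m') > 0"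
    if "m \<in> M" "m' \<in> M" "m \<noteq> m'" for m m'
    using that M total by (intro degree_diff_exponent_poly) auto
  have inj: "inj_on (exponent_poly k) M"
    using nonconst by (intro inj_onI) (metis degree_0 diff_self less_irrefl)
  show "XB G m = XB G' m"
  proof (cases "m \<in> M")
    \<comment> \<open>No colouring of either graph has monomial \<open>m\<close>, so both
      coefficients are 0.\<close>
    case False
    then show ?thesis
      using XB_eq_0 fin k by (metis M_def UnCI)
  next
    case True
    have "poly (XB G m) x = poly (XB G' m) x" for x
    proof -
      \<comment> \<open>With \<open>x\<close> fixed and \<open>q\<close> varying, these differences
        are the coefficients of a vanishing combination. The independence lemma is indexed by
        polynomials, so \<open>c\<close> is transported along the inverse of
        \<open>exponent_poly k\<close>.\<close>
      define c where "c m = poly (XB G m) x - poly (XB G' m) x" for m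
      have "(\<Sum>p\<in>exponent_poly k ` M. c (the_inv_into M (exponent_poly k) p) *
          r powr poly p (real q)) = 0" for q :: nat
      proof -
        have "(\<Sum>p\<in>exponent_poly k ` M. c (the_inv_into M (exponent_poly k) p) *
            r powr poly p (real q)) =
          (\<Sum>m\<in>M. c m * r powr real (\<Sum>i<k. Poly_Mapping.lookup m i * q ^ i))"
          by (simp only: sum.reindex[OF inj] o_def the_inv_into_f_f[OF inj] poly_exponent_poly
              cong: sum.cong)
        also have "\<dots> = (\<Sum>m\<in>M. c m * r ^ (\<Sum>i<k. Poly_Mapping.lookup m i * q ^ i))"
          using assms by (simp only: powr_realpow)
        also have "\<dots> = rq_dichromatic r q G x k - rq_dichromatic r q G' x k"
          using rq_dichromatic_eq_sum_XB[OF G(1) M(1) _ M(2)]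
            rq_dichromatic_eq_sum_XB[OF G(2) M(1) _ M(2)]
          by (simp add: M_def c_def left_diff_distrib sum_subtractf)
        finally show ?thesis
          by (simp add: eq)
      qed
      then have "c (the_inv_into M (exponent_poly k) (exponent_poly k m)) = 0"
        using nonconst True M
        by (intro powr_poly_independent[OF assms, where P = "exponent_poly k ` M"
              and c = "\<lambda>p. c (the_inv_into M (exponent_poly k) p)"]) auto
      then show ?thesis
        using True by (simp add: the_inv_into_f_f[OF inj] c_def)
    qed
    then show ?thesis
      by (intro poly_ext)
  qed
next
  fix G G' :: "('v, 'e) multigraph" and q x k
  assume G: "finite_graph G" "finite_graph G'" and eq: "XB G = XB G'"
  define M where "M = colour_types (verts G) k \<union> colour_types (verts G') k"
  have fin: "finite (verts G)" "finite (verts G')"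
    using G by (auto simp: finite_graph_def)
  have M: "finite M" "\<And>m. m \<in> M \<Longrightarrow> Poly_Mapping.keys m \<subseteq> {..<k}"
    using fin keys_colour_types by (auto simp: M_def finite_colour_types)
  \<comment> \<open>Over the common index set \<open>M\<close>, the two expansions depend on the
    graphs only through \<open>XB\<close>.\<close>
  show "rq_dichromatic r q G x k = rq_dichromatic r q G' x k"
    using rq_dichromatic_eq_sum_XB[OF G(1) M(1) _ M(2)]
      rq_dichromatic_eq_sum_XB[OF G(2) M(1) _ M(2)]
    by (simp add: M_def eq)
qed

end
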